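(* Let ${\cal D}=(V,{\cal B})$ be a Steiner triple system STS$(v)$ with $v>9$ and chromatic number $\chi({\cal D})=3$. Then for every point $y\in V$, the $3$-GDD ${\cal D}_y$ satisfies $\chi({\cal D}_y)=3$.
   Context: An STS$(v)$ is a pair $(V,{\cal B})$ with $|V|=v$ and ${\cal B}$ a collection of $3$-subsets (blocks) such that every pair of distinct points lies in exactly one block. For a point $y$, ${\cal D}_y$ denotes the $3$-GDD of type $2^{(v-1)/2}$ with point set $V\setminus\{y\}$, groups $\{B\setminus\{y\}: B\in{\cal B},\ y\in B\}$, and blocks $\{B\in{\cal B}: y\notin B\}$. A weak $c$-colouring is a map from the points to $c$ colours with no monochromatic block; the chromatic number $\chi$ is the least $c$ admitting a weak $c$-colouring. *)

theory Defs
  imports Main "HOL-Library.Disjoint_Sets"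
begin

record 'a design =
  points :: "'a set"
  blocks :: "'a set set"

record 'a gdd = "'a design" +
  groups :: "'a set set"

definition steiner_triple_system :: "nat \<Rightarrow> 'a design \<Rightarrow> bool" where
  "steiner_triple_system v D \<longleftrightarrow>
     finite (points D) \<and> card (points D) = v \<and>
     (\<forall>b \<in> blocks D. b \<subseteq> points D \<and> card b = 3) \<and>
     (\<forall>x \<in> points D. \<forall>z \<in> points D. x \<noteq> z \<longrightarrow> (\<exists>!b. b \<in> blocks D \<and> {x, z} \<subseteq> b))"

text \<open>A 3-GDD of type \<open>g\<^sup>u\<close>: the points are partitioned into \<open>u\<close> groups of size \<open>g\<close>.\<close>

definition three_gdd_of_type :: "nat \<Rightarrow> nat \<Rightarrow> 'a gdd \<Rightarrow> bool" where
  "three_gdd_of_type g u D \<longleftrightarrow>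
     finite (points D) \<and> partition_on (points D) (groups D) \<and>
     card (groups D) = u \<and> (\<forall>G \<in> groups D. card G = g) \<and>
     (\<forall>b \<in> blocks D. b \<subseteq> points D \<and> card b = 3) \<and>
     (\<forall>x \<in> points D. \<forall>z \<in> points D. x \<noteq> z \<longrightarrow>
        (if \<exists>G \<in> groups D. {x, z} \<subseteq> G
         then \<not> (\<exists>b \<in> blocks D. {x, z} \<subseteq> b)
         else \<exists>!b. b \<in> blocks D \<and> {x, z} \<subseteq> b))"

definition point_deleted_gdd :: "'a design \<Rightarrow> 'a \<Rightarrow> 'a gdd" where
  "point_deleted_gdd D y =
     \<lparr>points = points D - {y},
      blocks = {b \<in> blocks D. y \<notin> b},
      groups = {b - {y} | b. b \<in> blocks D \<and> y \<in> b}\<rparr>"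

text \<open>Only blocks are constrained by a weak colouring; the groups of a GDD may be monochromatic.\<close>

definition weak_colouring :: "('a, 'm) design_scheme \<Rightarrow> nat \<Rightarrow> ('a \<Rightarrow> nat) \<Rightarrow> bool" where
  "weak_colouring D c f \<longleftrightarrow>
     f ` points D \<subseteq> {..<c} \<and>
     (\<forall>b \<in> blocks D. \<not> (\<exists>k. \<forall>x \<in> b. f x = k))"

definition chromatic_number :: "('a, 'm) design_scheme \<Rightarrow> nat" where
  "chromatic_number D = (LEAST c. \<exists>f. weak_colouring D c f)"

lemma three_gdd_point_deleted_gdd:
  assumes sts: "steiner_triple_system v D" and y: "y \<in> points D"
  shows "three_gdd_of_type 2 ((v - 1) div 2) (point_deleted_gdd D y)"
proof -
  define V where "V = points D"
  define \<B> where "\<B> = blocks D"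
  define \<G> where "\<G> = {b - {y} | b. b \<in> \<B> \<and> y \<in> b}"
  have fin: "finite V" and cV: "card V = v" and yV: "y \<in> V"
    using sts y unfolding steiner_triple_system_def V_def by blast+
  have blk: "\<And>b. b \<in> \<B> \<Longrightarrow> b \<subseteq> V \<and> card b = 3"
    using sts unfolding steiner_triple_system_def V_def \<B>_def by blast
  have ex1: "\<exists>!b. b \<in> \<B> \<and> {x, z} \<subseteq> b" if "x \<in> V" "z \<in> V" "x \<noteq> z" for x z
  proof -
    have "\<forall>x \<in> V. \<forall>z \<in> V. x \<noteq> z \<longrightarrow> (\<exists>!b. b \<in> \<B> \<and> {x, z} \<subseteq> b)"
      using sts unfolding steiner_triple_system_def V_def \<B>_def by (elim conjE)
    with that show ?thesis by (simp only: simp_thms)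
  qed
  have ex: "\<exists>b. b \<in> \<B> \<and> x \<in> b \<and> z \<in> b" if "x \<in> V" "z \<in> V" "x \<noteq> z" for x z
    using ex1[OF that] by auto
  have uniq: "b = c" if "x \<noteq> z" "b \<in> \<B>" "c \<in> \<B>" "x \<in> b" "z \<in> b" "x \<in> c" "z \<in> c" for x z b c
  proof -
    have "x \<in> V" "z \<in> V" using blk that by blast+
    then show ?thesis using ex1[of x z] that by auto
  qed
  have c2: "card G = 2" if "G \<in> \<G>" for G
  proof -
    from that obtain b where "b \<in> \<B>" "y \<in> b" "G = b - {y}" unfolding \<G>_def by blast
    then show ?thesis using blk[of b] by simp
  qed
  have part: "partition_on (V - {y}) \<G>"
  proof (rule partition_onI)
    show "\<Union>\<G> = V - {y}"
    proof
      show "\<Union>\<G> \<subseteq> V - {y}" using blk unfolding \<G>_def by blast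
      show "V - {y} \<subseteq> \<Union>\<G>"
      proof
        fix x assume x: "x \<in> V - {y}"
        then obtain b where "b \<in> \<B>" "x \<in> b" "y \<in> b" using ex[of x y] yV by blast
        then have "b - {y} \<in> \<G>" "x \<in> b - {y}" using x unfolding \<G>_def by blast+
        then show "x \<in> \<Union>\<G>" by blast
      qed
    qed
    show "disjnt p q" if pq: "p \<in> \<G>" "q \<in> \<G>" "p \<noteq> q" for p q
    proof (rule ccontr)
      assume "\<not> disjnt p q"
      then obtain x where x: "x \<in> p" "x \<in> q" unfolding disjnt_def by blast
      obtain b c where bc: "b \<in> \<B>" "y \<in> b" "p = b - {y}" "c \<in> \<B>" "y \<in> c" "q = c - {y}"
        using pq(1,2) unfolding \<G>_def by blast
      have "b = c" using uniq[of x y b c] x bc by simp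
      then show False using pq bc by simp
    qed
    show "{} \<notin> \<G>" using c2[of "{}"] by auto
  qed
  have "card (V - {y}) = (\<Sum>G\<in>\<G>. card G)"
  proof -
    have "card (\<Union>\<G>) = (\<Sum>G\<in>\<G>. card G)"
    proof (rule card_Union_disjoint)
      show "pairwise disjnt \<G>" using part by (simp add: partition_on_def disjoint_def pairwise_def disjnt_def)
      show "finite G" if "G \<in> \<G>" for G using c2[OF that] by (simp add: card_ge_0_finite)
    qed
    then show ?thesis using part by (simp add: partition_on_def)
  qed
  then have "v - 1 = card \<G> * 2" using c2 fin cV yV by simp
  then have cG: "card \<G> = (v - 1) div 2" by simp
  have pairs: "if \<exists>G \<in> \<G>. {x, z} \<subseteq> G
         then \<not> (\<exists>b \<in> {b \<in> \<B>. y \<notin> b}. {x, z} \<subseteq> b)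
         else \<exists>!b. b \<in> {b \<in> \<B>. y \<notin> b} \<and> {x, z} \<subseteq> b"
    if xz: "x \<in> V - {y}" "z \<in> V - {y}" "x \<noteq> z" for x z
  proof (cases "\<exists>G \<in> \<G>. {x, z} \<subseteq> G")
    case True
    then obtain c where c: "c \<in> \<B>" "y \<in> c" "x \<in> c" "z \<in> c" unfolding \<G>_def by blast
    have "b = c" if "b \<in> \<B>" "x \<in> b" "z \<in> b" for b
      using uniq[OF xz(3) that(1) c(1) that(2,3) c(3,4)] .
    then have "\<not> (\<exists>b \<in> {b \<in> \<B>. y \<notin> b}. {x, z} \<subseteq> b)"
      using c(2) by auto
    then show ?thesis using True by simp
  next
    case False
    obtain b where b: "b \<in> \<B>" "x \<in> b" "z \<in> b" using ex[of x z] xz by blast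
    have yb: "y \<notin> b"
    proof
      assume "y \<in> b"
      then have "b - {y} \<in> \<G>" using b unfolding \<G>_def by blast
      moreover have "{x, z} \<subseteq> b - {y}" using b xz by simp
      ultimately show False using False by (metis (no_types))
    qed
    have "\<exists>!b. b \<in> {b \<in> \<B>. y \<notin> b} \<and> {x, z} \<subseteq> b"
    proof (rule ex1I)
      show "b \<in> {b \<in> \<B>. y \<notin> b} \<and> {x, z} \<subseteq> b" using b yb by simp
      fix c assume "c \<in> {b \<in> \<B>. y \<notin> b} \<and> {x, z} \<subseteq> c"
      then have "c \<in> \<B>" "x \<in> c" "z \<in> c" by simp_all
      then show "c = b" using uniq[OF xz(3) _ b(1) _ _ b(2,3)] by (simp only:)
    qed
    then show ?thesis by (subst if_not_P[OF False])
  qed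
  show ?thesis
    unfolding three_gdd_of_type_def point_deleted_gdd_def V_def[symmetric] \<B>_def[symmetric]
      design.simps gdd.simps \<G>_def[symmetric]
  proof (intro conjI ballI impI)
    show "finite (V - {y})" using fin by simp
    show "b \<subseteq> V - {y}" "card b = 3" if "b \<in> {b \<in> \<B>. y \<notin> b}" for b
      using that blk[of b] by auto
    show "partition_on (V - {y}) \<G>" by (fact part)
    show "card \<G> = (v - 1) div 2" by (fact cG)
    show "card G = 2" if "G \<in> \<G>" for G by (rule c2[OF that])
  qed (rule pairs)
qed

end

theory Submission
  imports Defs
begin

text \<open>
  In a 3-GDD of type \<open>g\<^sup>u\<close> with a weak 2-colouring, every block contains exactly two
  bichromatic pairs, so the colour classes \<open>A\<close> and \<open>C\<close> satisfy \<open>2b \<le> |A||C| \<le> (gu)\<^sup>2/4\<close>,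
  where \<open>b\<close> is the number of blocks. Counting all pairs gives \<open>6b = g\<^sup>2u(u - 1)\<close>, and the two
  together force \<open>u \<le> 4\<close>. For a point-deleted STS(\<open>v\<close>) this reads \<open>v \<le> 9\<close>.
\<close>

section \<open>Double counting in a 3-GDD\<close>

text \<open>Counting ordered rather than unordered pairs avoids halving in the natural numbers: a
  block contributes 6 and a group of size \<open>g\<close> contributes
  \<open>g * (g - 1)\<close>.\<close>

definition ordered_pairs :: "'a set \<Rightarrow> ('a \<times> 'a) set" where
  "ordered_pairs S = {(x, z). x \<in> S \<and> z \<in> S \<and> x \<noteq> z}"

lemma finite_ordered_pairs: "finite S \<Longrightarrow> finite (ordered_pairs S)"
  by (rule finite_subset[of _ "S \<times> S"]) (auto simp: ordered_pairs_def)

lemma card_ordered_pairs: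
  assumes "finite S"
  shows "card (ordered_pairs S) = card S * (card S - 1)"
proof -
  have "ordered_pairs S = (SIGMA x:S. S - {x})"
    unfolding ordered_pairs_def by auto
  then show ?thesis using assms by simp
qed

lemma three_gdd_card_points:
  assumes "three_gdd_of_type g u D"
  shows "card (points D) = g * u"
proof -
  have fin: "finite (points D)" and part: "partition_on (points D) (groups D)"
    and card: "card (groups D) = u" "\<And>G. G \<in> groups D \<Longrightarrow> card G = g"
    using assms unfolding three_gdd_of_type_def by blast+
  have "card (\<Union>(groups D)) = (\<Sum>G\<in>groups D. card G)"
  proof (rule card_Union_disjoint)
    show "pairwise disjnt (groups D)"
      using part by (simp add: partition_on_def disjoint_def pairwise_def disjnt_def)
    show "finite G" if "G \<in> groups D" for G
      using fin part that unfolding partition_on_def by (metis Union_upper finite_subset)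
  qed
  then show ?thesis
    using part card by (simp add: partition_on_def mult.commute)
qed

lemma three_gdd_pair:
  assumes "three_gdd_of_type g u D" "x \<in> points D" "z \<in> points D" "x \<noteq> z"
  shows "if \<exists>G \<in> groups D. {x, z} \<subseteq> G
         then \<not> (\<exists>b \<in> blocks D. {x, z} \<subseteq> b)
         else \<exists>!b. b \<in> blocks D \<and> {x, z} \<subseteq> b"
proof -
  have *: "\<forall>x \<in> points D. \<forall>z \<in> points D. x \<noteq> z \<longrightarrow>
        (if \<exists>G \<in> groups D. {x, z} \<subseteq> G
         then \<not> (\<exists>b \<in> blocks D. {x, z} \<subseteq> b)
         else \<exists>!b. b \<in> blocks D \<and> {x, z} \<subseteq> b)"
    using assms(1) unfolding three_gdd_of_type_def by (elim conjE)
  show ?thesis by (rule *[THEN bspec, THEN bspec, THEN mp, OF assms(2-4)])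
qed

text \<open>Two points of a block never share a group, since pairs inside a group lie in no block;
  so the uniqueness half of the GDD axiom applies to them.\<close>

lemma three_gdd_block_unique:
  assumes "three_gdd_of_type g u D" "b \<in> blocks D" "c \<in> blocks D"
    and "x \<noteq> z" "{x, z} \<subseteq> b" "{x, z} \<subseteq> c"
  shows "b = c"
proof -
  have "x \<in> points D" "z \<in> points D"
    using assms unfolding three_gdd_of_type_def by blast+
  note pair = three_gdd_pair[OF assms(1) this assms(4)]
  have "\<exists>!b. b \<in> blocks D \<and> {x, z} \<subseteq> b"
  proof (cases "\<exists>G \<in> groups D. {x, z} \<subseteq> G")
    case True
    from pair[unfolded if_P[OF True]] show ?thesis using assms(2,5) by blast
  next
    case False
    show ?thesis by (rule pair[unfolded if_not_P[OF False]])
  qed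
  then show ?thesis using assms(2,3,5,6) by blast
qed

text \<open>The ordered pairs of distinct points split into those covered by a block and those
  covered by a group. Keeping the group term on the left avoids subtracting it in the natural
  numbers.\<close>

lemma three_gdd_card_blocks:
  assumes gdd: "three_gdd_of_type g u D"
  shows "6 * card (blocks D) + u * (g * (g - 1)) = g * u * (g * u - 1)"
proof -
  have fin: "finite (points D)" and part: "partition_on (points D) (groups D)"
    and cG: "card (groups D) = u" "\<And>G. G \<in> groups D \<Longrightarrow> card G = g"
    and blk: "\<And>b. b \<in> blocks D \<Longrightarrow> b \<subseteq> points D" "\<And>b. b \<in> blocks D \<Longrightarrow> card b = 3"
    using gdd unfolding three_gdd_of_type_def by blast+
  have grp: "G \<subseteq> points D" if "G \<in> groups D" for G
    using part that unfolding partition_on_def by blast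
  have finB: "finite (blocks D)" and finG: "finite (groups D)"
    using fin blk(1) grp by (meson Pow_iff finite_Pow_iff finite_subset subsetI)+
  let ?PB = "\<Union>b\<in>blocks D. ordered_pairs b" and ?PG = "\<Union>G\<in>groups D. ordered_pairs G"
  have "card ?PB = (\<Sum>b\<in>blocks D. card (ordered_pairs b))"
  proof (rule card_UN_disjoint[OF finB])
    show "\<forall>b\<in>blocks D. finite (ordered_pairs b)"
      using blk(1) fin finite_ordered_pairs finite_subset by metis
    show "\<forall>b\<in>blocks D. \<forall>c\<in>blocks D. b \<noteq> c \<longrightarrow> ordered_pairs b \<inter> ordered_pairs c = {}"
      using three_gdd_block_unique[OF gdd] unfolding ordered_pairs_def by auto
  qed
  also have "\<dots> = (\<Sum>b\<in>blocks D. 6)"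
    using blk by (intro sum.cong refl) (simp add: card_ordered_pairs finite_subset[OF _ fin])
  finally have PB: "card ?PB = 6 * card (blocks D)" by simp
  have "card ?PG = (\<Sum>G\<in>groups D. card (ordered_pairs G))"
  proof (rule card_UN_disjoint[OF finG])
    show "\<forall>G\<in>groups D. finite (ordered_pairs G)"
      using grp fin finite_ordered_pairs finite_subset by metis
    show "\<forall>G\<in>groups D. \<forall>H\<in>groups D. G \<noteq> H \<longrightarrow> ordered_pairs G \<inter> ordered_pairs H = {}"
      using part unfolding ordered_pairs_def partition_on_def disjoint_def by blast
  qed
  also have "\<dots> = (\<Sum>G\<in>groups D. g * (g - 1))"
    using grp cG by (intro sum.cong refl) (simp add: card_ordered_pairs finite_subset[OF _ fin])
  finally have PG: "card ?PG = u * (g * (g - 1))" using cG by simp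
  \<comment> \<open>The inequality of truth values is an exclusive or: it yields both that the two
    families of pairs exhaust all pairs (\<open>union\<close>) and that they do not overlap
    (\<open>disj\<close>).\<close>
  have pair_cases: "((x, z) \<in> ?PB) \<noteq> ((x, z) \<in> ?PG)" if "(x, z) \<in> ordered_pairs (points D)" for x z
  proof -
    have xz: "x \<in> points D" "z \<in> points D" "x \<noteq> z" using that by (auto simp: ordered_pairs_def)
    have "(x, z) \<in> ?PB \<longleftrightarrow> (\<exists>b \<in> blocks D. {x, z} \<subseteq> b)" "(x, z) \<in> ?PG \<longleftrightarrow> (\<exists>G \<in> groups D. {x, z} \<subseteq> G)"
      using xz(3) by (auto simp: ordered_pairs_def)
    moreover have "(\<exists>b \<in> blocks D. {x, z} \<subseteq> b) \<noteq> (\<exists>G \<in> groups D. {x, z} \<subseteq> G)"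
    proof (cases "\<exists>G \<in> groups D. {x, z} \<subseteq> G")
      case True
      from three_gdd_pair[OF gdd xz, unfolded if_P[OF True]] True show ?thesis by argo
    next
      case False
      from three_gdd_pair[OF gdd xz, unfolded if_not_P[OF False]] False show ?thesis by metis
    qed
    ultimately show ?thesis by argo
  qed
  have sub: "?PB \<subseteq> ordered_pairs (points D)" "?PG \<subseteq> ordered_pairs (points D)"
    using blk(1) grp unfolding ordered_pairs_def by blast+
  have union: "ordered_pairs (points D) = ?PB \<union> ?PG"
  proof (intro equalityI subrelI)
    fix x z assume "(x, z) \<in> ordered_pairs (points D)"
    from pair_cases[OF this] show "(x, z) \<in> ?PB \<union> ?PG" unfolding Un_iff by argo
  next
    fix x z assume "(x, z) \<in> ?PB \<union> ?PG"
    then show "(x, z) \<in> ordered_pairs (points D)" using Un_least[OF sub] by (rule rev_subsetD)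
  qed
  have disj: "?PB \<inter> ?PG = {}"
  proof (rule equals0I)
    fix p assume p: "p \<in> ?PB \<inter> ?PG"
    obtain x z where xz: "p = (x, z)" by (cases p)
    have "(x, z) \<in> ordered_pairs (points D)" using p sub(1) unfolding xz by (meson IntD1 subsetD)
    from pair_cases[OF this] p show False unfolding xz Int_iff by argo
  qed
  have "finite ?PB" "finite ?PG"
    using sub finite_ordered_pairs[OF fin] finite_subset by blast+
  then have "card (ordered_pairs (points D)) = card ?PB + card ?PG"
    unfolding union by (rule card_Un_disjoint[OF _ _ disj])
  then show ?thesis
    using PB PG card_ordered_pairs[OF fin] three_gdd_card_points[OF gdd] by simp
qed

section \<open>Weak 2-colourings of a 3-GDD\<close>

text \<open>Orienting every bichromatic pair from colour 0 to colour 1 counts it once, as an element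
  of \<open>A \<times> C\<close>. The factor 8 is the 2 pairs per block times the 4 from the
  inequality of arithmetic and geometric means.\<close>

lemma two_colourable_three_gdd_card_blocks:
  assumes gdd: "three_gdd_of_type g u D" and col: "weak_colouring D 2 f"
  shows "8 * card (blocks D) \<le> (g * u)\<^sup>2"
proof -
  have fin: "finite (points D)"
    and blk: "\<And>b. b \<in> blocks D \<Longrightarrow> b \<subseteq> points D" "\<And>b. b \<in> blocks D \<Longrightarrow> card b = 3"
    using gdd unfolding three_gdd_of_type_def by blast+
  have finB: "finite (blocks D)"
    using fin blk(1) by (meson Pow_iff finite_Pow_iff finite_subset subsetI)
  define A where "A = {x \<in> points D. f x = 0}"
  define C where "C = {x \<in> points D. f x = 1}"
  have range: "f x = 0 \<or> f x = 1" if "x \<in> points D" for x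
  proof -
    have "f ` points D \<subseteq> {..<2}" using col unfolding weak_colouring_def by (elim conjE)
    then have "f x < 2" using that by blast
    then show ?thesis by (simp add: less_2_cases_iff)
  qed
  have AC: "A \<union> C = points D" "A \<inter> C = {}" "finite A" "finite C"
    using range fin unfolding A_def C_def by auto
  have two: "card ((b \<inter> A) \<times> (b \<inter> C)) = 2" if b: "b \<in> blocks D" for b
  proof -
    have "b = (b \<inter> A) \<union> (b \<inter> C)" using AC blk(1)[OF b] by blast
    moreover have "card ((b \<inter> A) \<union> (b \<inter> C)) = card (b \<inter> A) + card (b \<inter> C)"
      using AC by (intro card_Un_disjoint) auto
    ultimately have sum: "card (b \<inter> A) + card (b \<inter> C) = 3" using blk(2)[OF b] by simp
    \<comment> \<open>Taking \<open>k\<close> to be 1 gives a point of \<open>b\<close> in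
      \<open>A\<close>, and taking it to be 0 gives one in \<open>C\<close>.\<close>
    have no_mono: "\<exists>x\<in>b. f x \<noteq> k" for k
      using col b unfolding weak_colouring_def by blast
    have "b \<inter> A \<noteq> {}" "b \<inter> C \<noteq> {}"
      using no_mono range blk(1)[OF b] unfolding A_def C_def by blast+
    then have "card (b \<inter> A) > 0" "card (b \<inter> C) > 0" using AC by (simp_all add: card_gt_0_iff)
    with sum have "card (b \<inter> A) = 1 \<and> card (b \<inter> C) = 2 \<or> card (b \<inter> A) = 2 \<and> card (b \<inter> C) = 1"
      by arith
    then show ?thesis by (auto simp: card_cartesian_product)
  qed
  have "card (\<Union>b\<in>blocks D. (b \<inter> A) \<times> (b \<inter> C)) = (\<Sum>b\<in>blocks D. card ((b \<inter> A) \<times> (b \<inter> C)))"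
  proof (rule card_UN_disjoint[OF finB])
    show "\<forall>b\<in>blocks D. finite ((b \<inter> A) \<times> (b \<inter> C))" using AC by simp
    show "\<forall>b\<in>blocks D. \<forall>c\<in>blocks D. b \<noteq> c \<longrightarrow> (b \<inter> A) \<times> (b \<inter> C) \<inter> (c \<inter> A) \<times> (c \<inter> C) = {}"
    proof (intro ballI impI equals0I)
      fix b c p
      assume bc: "b \<in> blocks D" "c \<in> blocks D" "b \<noteq> c"
        and p: "p \<in> (b \<inter> A) \<times> (b \<inter> C) \<inter> (c \<inter> A) \<times> (c \<inter> C)"
      then obtain x z where "x \<in> A" "z \<in> C" "{x, z} \<subseteq> b" "{x, z} \<subseteq> c" by auto
      moreover from this have "x \<noteq> z" using AC by blast
      ultimately show False using three_gdd_block_unique[OF gdd bc(1,2)] bc(3) by blast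
    qed
  qed
  also have "\<dots> = 2 * card (blocks D)" using two by simp
  finally have union: "card (\<Union>b\<in>blocks D. (b \<inter> A) \<times> (b \<inter> C)) = 2 * card (blocks D)" .
  have "card (\<Union>b\<in>blocks D. (b \<inter> A) \<times> (b \<inter> C)) \<le> card (A \<times> C)"
    using AC(3,4) by (intro card_mono) auto
  then have "2 * card (blocks D) \<le> card (A \<times> C)" unfolding union .
  moreover have "card A + card C = g * u"
    using card_Un_disjoint[of A C] AC three_gdd_card_points[OF gdd] by simp
  moreover have "4 * (card A * card C) \<le> (card A + card C)\<^sup>2"
  proof -
    \<comment> \<open>The square of the difference is taken over the integers because subtraction of
      naturals truncates.\<close>
    have "0 \<le> (int (card A) - int (card C))\<^sup>2" by simp
    then have "int (4 * (card A * card C)) \<le> int ((card A + card C)\<^sup>2)"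
      by (simp add: power2_eq_square algebra_simps)
    then show ?thesis by (rule of_nat_le_iff[THEN iffD1])
  qed
  ultimately show ?thesis by (simp add: card_cartesian_product)
qed

text \<open>Put \<open>u = w + 1\<close> and let \<open>b\<close> be the number of blocks. Then
  \<open>6b = g * g * u * w\<close> and \<open>8b \<le> g * g * u * u\<close> give
  \<open>4w \<le> 3u = 3w + 3\<close>, so \<open>w \<le> 3\<close>.\<close>

lemma two_colourable_three_gdd_at_most_four_groups:
  assumes gdd: "three_gdd_of_type g u D" and "g > 0" and col: "weak_colouring D 2 f"
  shows "u \<le> 4"
proof (cases "u = 0")
  case False
  obtain h w where hw: "g = Suc h" "u = Suc w" using False \<open>g > 0\<close> by (metis gr0_implies_Suc not_gr0)
  \<comment> \<open>Each of the \<open>g * u\<close> points has \<open>g * w\<close> partners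
    outside its group; the second summand counts the pairs inside groups and cancels against the
    block count.\<close>
  have "g * u * (g * u - 1) = g * u * (g * w) + u * (g * (g - 1))"
    unfolding hw by (simp add: algebra_simps)
  then have "6 * card (blocks D) = g * u * (g * w)"
    using three_gdd_card_blocks[OF gdd] by simp
  then have "4 * (g * u * (g * w)) \<le> 3 * (g * u)\<^sup>2"
    using two_colourable_three_gdd_card_blocks[OF gdd col] by simp
  then have "(g * g * u) * (4 * w) \<le> (g * g * u) * (3 * u)"
    by (simp add: power2_eq_square mult_ac)
  then have "4 * w \<le> 3 * u" using \<open>g > 0\<close> False by simp
  then show ?thesis using hw by simp
qed simp

section \<open>Chromatic number of the point-deleted GDD\<close>

lemma weak_colouring_mono:
  assumes "weak_colouring D c f" "c \<le> d"
  shows "weak_colouring D d f"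
  using assms lessThan_subset_iff[of c d] unfolding weak_colouring_def by (meson subset_trans)

text \<open>An injective colouring leaves no block of three points monochromatic. Some colouring
  must exist before the \<open>LEAST\<close> in \<open>chromatic_number\<close> is known to be
  attained.\<close>

lemma sts_weakly_colourable:
  assumes "steiner_triple_system v D"
  shows "\<exists>f. weak_colouring D v f"
proof -
  have fin: "finite (points D)" and card: "card (points D) = v"
    and blk: "\<And>b. b \<in> blocks D \<Longrightarrow> b \<subseteq> points D" "\<And>b. b \<in> blocks D \<Longrightarrow> card b = 3"
    using assms unfolding steiner_triple_system_def by blast+
  obtain f where f: "bij_betw f (points D) {..<v}"
    using ex_bij_betw_finite_nat[OF fin] card by (auto simp: lessThan_atLeast0)
  have "\<not> (\<exists>k. \<forall>x\<in>b. f x = k)" if b: "b \<in> blocks D" for b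
  proof
    assume "\<exists>k. \<forall>x\<in>b. f x = k"
    then obtain k where "f ` b \<subseteq> {k}" by blast
    then have "card (f ` b) \<le> 1" using card_mono[of "{k}" "f ` b"] by simp
    moreover have "inj_on f b" using f blk(1)[OF b] by (meson bij_betw_imp_inj_on inj_on_subset)
    ultimately show False using blk(2)[OF b] by (simp add: card_image)
  qed
  then show ?thesis using f unfolding weak_colouring_def bij_betw_def by blast
qed

theorem theorem3p11:
  fixes D :: "'a design" and v :: nat
  assumes "steiner_triple_system v D"
    and "v > 9"
    and "chromatic_number D = 3"
  shows "\<forall>y \<in> points D. chromatic_number (point_deleted_gdd D y) = 3"
proof
  fix y assume y: "y \<in> points D"
  let ?E = "point_deleted_gdd D y"
  have "\<exists>f. weak_colouring D (chromatic_number D) f"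
    unfolding chromatic_number_def by (rule LeastI_ex) (use sts_weakly_colourable assms(1) in blast)
  then obtain f where "weak_colouring D 3 f" using assms(3) by auto
  \<comment> \<open>Deleting \<open>y\<close> only removes points and blocks, so the same colouring
    still works.\<close>
  then have three: "weak_colouring ?E 3 f"
    unfolding weak_colouring_def point_deleted_gdd_def by auto
  have gdd: "three_gdd_of_type 2 ((v - 1) div 2) ?E"
    using three_gdd_point_deleted_gdd[OF assms(1) y] .
  have "card (points ?E) = v - 1"
    using assms(1) y unfolding steiner_triple_system_def point_deleted_gdd_def by simp
  \<comment> \<open>The groups of size 2 partition \<open>v - 1\<close> points, so \<open>v\<close>
    is odd. This rules out \<open>v = 10\<close>, where the rounded quotient would be only
    4.\<close>
  then have "v - 1 = 2 * ((v - 1) div 2)" using three_gdd_card_points[OF gdd] by simp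
  then have many_groups: "(v - 1) div 2 > 4" using \<open>v > 9\<close> by linarith
  show "chromatic_number ?E = 3"
    unfolding chromatic_number_def
  proof (rule Least_equality)
    show "\<exists>f. weak_colouring ?E 3 f" using three by blast
    fix c assume "\<exists>f. weak_colouring ?E c f"
    then obtain h where h: "weak_colouring ?E c h" by blast
    show "3 \<le> c"
    proof (rule ccontr)
      assume "\<not> 3 \<le> c"
      \<comment> \<open>Fewer than three colours means at most two, so a single bound for
        2-colourings covers every smaller \<open>c\<close>.\<close>
      then have "weak_colouring ?E 2 h" using weak_colouring_mono[OF h] by simp
      then show False
        using two_colourable_three_gdd_at_most_four_groups[OF gdd] many_groups by fastforce
    qed
  qed
qed

end
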